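(* Let $n\ge 1$. The six pairs of set-valued statistics $$(\mathrm{Asc},\mathrm{Dasc}),\ (\mathrm{Plat},\mathrm{Dplat}),\ (\mathrm{Des},\mathrm{Ddes}),\ (\mathrm{Asc},\mathrm{Uu}),\ (\mathrm{Plat},\mathrm{Pasc}),\ (\mathrm{Des},\mathrm{Dd})$$ are all equidistributed on $\mathcal{Q}_n$. Consequently the following four identities hold: $$\sum_{\sigma\in\mathcal{Q}_n}x^{\mathrm{asc}(\sigma)}y^{\mathrm{dasc}(\sigma)}=\sum_{\sigma\in\mathcal{Q}_n}x^{\mathrm{plat}(\sigma)}y^{\mathrm{dplat}(\sigma)}=\sum_{\sigma\in\mathcal{Q}_n}x^{\mathrm{des}(\sigma)}y^{\mathrm{ddes}(\sigma)},$$ $$\sum_{\sigma\in\mathcal{Q}_n}x^{\mathrm{asc}(\sigma)}y^{\mathrm{dasc}(\sigma)}=\sum_{\sigma\in\mathcal{Q}_n}x^{\mathrm{plat}(\sigma)}y^{\mathrm{pasc}(\sigma)}=\sum_{\sigma\in\mathcal{Q}_n}x^{\mathrm{des}(\sigma)}y^{\mathrm{ddes}(\sigma)},$$ $$\sum_{\sigma\in\mathcal{Q}_n}x^{\mathrm{asc}(\sigma)}y^{\mathrm{uu}(\sigma)}=\sum_{\sigma\in\mathcal{Q}_n}x^{\mathrm{plat}(\sigma)}y^{\mathrm{pasc}(\sigma)}=\sum_{\sigma\in\mathcal{Q}_n}x^{\mathrm{des}(\sigma)}y^{\mathrm{dd}(\sigma)},$$ $$\sum_{\sigma\in\mathcal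{Q}_n}x^{\mathrm{asc}(\sigma)}y^{\mathrm{uu}(\sigma)}=\sum_{\sigma\in\mathcal{Q}_n}x^{\mathrm{plat}(\sigma)}y^{\mathrm{dplat}(\sigma)}=\sum_{\sigma\in\mathcal{Q}_n}x^{\mathrm{des}(\sigma)}y^{\mathrm{dd}(\sigma)}.$$
   Context: $\mathcal{Q}_n$ is the set of Stirling permutations of order $n$: words $\sigma=\sigma_1\cdots\sigma_{2n}$ that are arrangements of the multiset $\{1,1,2,2,\ldots,n,n\}$ such that whenever $i<s<j$ and $\sigma_i=\sigma_j$ one has $\sigma_s\ge\sigma_i$. Set $\sigma_0=\sigma_{2n+1}=0$. All sets below are subsets of $[n]=\{1,\ldots,n\}$ (sets of values), with indices $i,j$ ranging over $\{1,\ldots,2n\}$: - $\mathrm{Asc}(\sigma)=\{\sigma_i\mid\sigma_{i-1}<\sigma_i\}$ - $\mathrm{Plat}(\sigma)=\{\sigma_i\mid\sigma_i=\sigma_{i+1}\}$ - $\mathrm{Des}(\sigma)=\{\sigma_i\mid\sigma_i>\sigma_{i+1}\}$ - $\mathrm{Dasc}(\sigma)=\{\sigma_i\mid\sigma_{i-1}<\sigma_i<\sigma_{i+1}\}$ - $\mathrm{Dplat}(\sigma)=\{\sigma_i\mid\sigma_{i-1}>\sigma_i=\sigma_{i+1}\}$ - $\mathrm{Ddes}(\sigma)=\{\sigma_i\mid\sigma_{i-1}>\sigma_i>\sigma_{i+1}\}$ - $\mathrm{Pasc}(\sigma)=\{\sigma_i\mid\sigma_{i-1}=\sigma_i<\sigma_{i+1}\}$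 - $\mathrm{Uu}(\sigma)=\{\sigma_i\mid\sigma_{i-1}<\sigma_i=\sigma_j<\sigma_{j+1}\text{ for some } j>i\}$ - $\mathrm{Dd}(\sigma)=\{\sigma_i\mid\sigma_{i-1}>\sigma_i=\sigma_j>\sigma_{j+1}\text{ for some } j>i\}$ The lower-case statistics $\mathrm{asc},\mathrm{plat},\mathrm{des},\mathrm{dasc},\mathrm{dplat},\mathrm{ddes},\mathrm{pasc},\mathrm{uu},\mathrm{dd}$ denote the cardinalities of the corresponding sets. Two pairs $(S,T)$ and $(S',T')$ of set-valued statistics are equidistributed on $\mathcal{Q}_n$ if for all $A,B\subseteq[n]$ the number of $\sigma\in\mathcal{Q}_n$ with $S(\sigma)=A$, $T(\sigma)=B$ equals the number of $\sigma\in\mathcal{Q}_n$ with $S'(\sigma)=A$, $T'(\sigma)=B$. *)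

theory Defs
  imports Main "HOL-Library.Multiset"
begin

text \<open>
  A word is a list; \<open>letter \<sigma> i\<close> is its \<open>i\<close>-th letter in 1-based indexing, with the boundary
  convention that the letters at positions \<open>0\<close> and \<open>length \<sigma> + 1\<close> are \<open>0\<close>.
  Only positions up to \<open>length \<sigma> + 1\<close> are meaningful.
\<close>

definition letter :: "nat list \<Rightarrow> nat \<Rightarrow> nat" where
  "letter \<sigma> i = (0 # \<sigma> @ [0]) ! i"

definition positions :: "nat list \<Rightarrow> nat set" where
  "positions \<sigma> = {1..length \<sigma>}"

definition stirling_perms :: "nat \<Rightarrow> nat list set" where
  "stirling_perms n =
    {\<sigma>. mset \<sigma> = mset_set {1..n} + mset_set {1..n} \<and>
        (\<forall>i\<in>positions \<sigma>. \<forall>s\<in>positions \<sigma>. \<forall>j\<in>positions \<sigma>.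
           i < s \<and> s < j \<and> letter \<sigma> i = letter \<sigma> j \<longrightarrow> letter \<sigma> s \<ge> letter \<sigma> i)}"

lemma finite_stirling_perms: "finite (stirling_perms n)"
proof (rule finite_subset)
  show "stirling_perms n \<subseteq> {\<sigma>. set \<sigma> \<subseteq> {1..n} \<and> length \<sigma> = n + n}"
  proof
    fix \<sigma> assume "\<sigma> \<in> stirling_perms n"
    then have "mset \<sigma> = mset_set {1..n} + mset_set {1..n}"
      by (simp add: stirling_perms_def)
    from arg_cong [OF this, of set_mset] arg_cong [OF this, of size]
    show "\<sigma> \<in> {\<sigma>. set \<sigma> \<subseteq> {1..n} \<and> length \<sigma> = n + n}" by simp
  qed
  show "finite {\<sigma>. set \<sigma> \<subseteq> {1..n} \<and> length \<sigma> = n + n}"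
    by (rule finite_lists_length_eq) simp
qed

definition Asc :: "nat list \<Rightarrow> nat set" where
  "Asc \<sigma> = {letter \<sigma> i | i. i \<in> positions \<sigma> \<and> letter \<sigma> (i - 1) < letter \<sigma> i}"

definition Plat :: "nat list \<Rightarrow> nat set" where
  "Plat \<sigma> = {letter \<sigma> i | i. i \<in> positions \<sigma> \<and> letter \<sigma> i = letter \<sigma> (i + 1)}"

definition Des :: "nat list \<Rightarrow> nat set" where
  "Des \<sigma> = {letter \<sigma> i | i. i \<in> positions \<sigma> \<and> letter \<sigma> i > letter \<sigma> (i + 1)}"

definition Dasc :: "nat list \<Rightarrow> nat set" where
  "Dasc \<sigma> = {letter \<sigma> i | i. i \<in> positions \<sigma> \<and>
     letter \<sigma> (i - 1) < letter \<sigma> i \<and> letter \<sigma> i < letter \<sigma> (i + 1)}"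

definition Dplat :: "nat list \<Rightarrow> nat set" where
  "Dplat \<sigma> = {letter \<sigma> i | i. i \<in> positions \<sigma> \<and>
     letter \<sigma> (i - 1) > letter \<sigma> i \<and> letter \<sigma> i = letter \<sigma> (i + 1)}"

definition Ddes :: "nat list \<Rightarrow> nat set" where
  "Ddes \<sigma> = {letter \<sigma> i | i. i \<in> positions \<sigma> \<and>
     letter \<sigma> (i - 1) > letter \<sigma> i \<and> letter \<sigma> i > letter \<sigma> (i + 1)}"

definition Pasc :: "nat list \<Rightarrow> nat set" where
  "Pasc \<sigma> = {letter \<sigma> i | i. i \<in> positions \<sigma> \<and>
     letter \<sigma> (i - 1) = letter \<sigma> i \<and> letter \<sigma> i < letter \<sigma> (i + 1)}"

definition Uu :: "nat list \<Rightarrow> nat set" where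
  "Uu \<sigma> = {letter \<sigma> i | i. i \<in> positions \<sigma> \<and>
     (\<exists>j\<in>positions \<sigma>. j > i \<and> letter \<sigma> (i - 1) < letter \<sigma> i \<and>
        letter \<sigma> i = letter \<sigma> j \<and> letter \<sigma> j < letter \<sigma> (j + 1))}"

definition Dd :: "nat list \<Rightarrow> nat set" where
  "Dd \<sigma> = {letter \<sigma> i | i. i \<in> positions \<sigma> \<and>
     (\<exists>j\<in>positions \<sigma>. j > i \<and> letter \<sigma> (i - 1) > letter \<sigma> i \<and>
        letter \<sigma> i = letter \<sigma> j \<and> letter \<sigma> j > letter \<sigma> (j + 1))}"

definition asc :: "nat list \<Rightarrow> nat" where "asc \<sigma> = card (Asc \<sigma>)"
definition plat :: "nat list \<Rightarrow> nat" where "plat \<sigma> = card (Plat \<sigma>)"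
definition des :: "nat list \<Rightarrow> nat" where "des \<sigma> = card (Des \<sigma>)"
definition dasc :: "nat list \<Rightarrow> nat" where "dasc \<sigma> = card (Dasc \<sigma>)"
definition dplat :: "nat list \<Rightarrow> nat" where "dplat \<sigma> = card (Dplat \<sigma>)"
definition ddes :: "nat list \<Rightarrow> nat" where "ddes \<sigma> = card (Ddes \<sigma>)"
definition pasc :: "nat list \<Rightarrow> nat" where "pasc \<sigma> = card (Pasc \<sigma>)"
definition uu :: "nat list \<Rightarrow> nat" where "uu \<sigma> = card (Uu \<sigma>)"
definition dd :: "nat list \<Rightarrow> nat" where "dd \<sigma> = card (Dd \<sigma>)"

type_synonym set_statistic = "nat list \<Rightarrow> nat set"

definition equidistributed ::
    "nat \<Rightarrow> set_statistic \<times> set_statistic \<Rightarrow> set_statistic \<times> set_statistic \<Rightarrow> bool" where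
  "equidistributed n = (\<lambda>(S, T) (S', T').
     \<forall>A B. A \<subseteq> {1..n} \<and> B \<subseteq> {1..n} \<longrightarrow>
       card {\<sigma> \<in> stirling_perms n. S \<sigma> = A \<and> T \<sigma> = B} =
       card {\<sigma> \<in> stirling_perms n. S' \<sigma> = A \<and> T' \<sigma> = B})"

text \<open>
  The generating function is evaluated at arbitrary elements of an arbitrary commutative
  semiring. Identities between such evaluations, for all semirings and all \<open>x\<close>, \<open>y\<close>, amount to
  identities of polynomials in two commuting indeterminates: take the semiring to be a
  polynomial semiring and \<open>x\<close>, \<open>y\<close> its indeterminates.
\<close>

definition gen_fun ::
    "nat \<Rightarrow> (nat list \<Rightarrow> nat) \<Rightarrow> (nat list \<Rightarrow> nat) \<Rightarrow> 'a \<Rightarrow> 'a \<Rightarrow> 'a::comm_semiring_1" where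
  "gen_fun n s t x y = (\<Sum>\<sigma>\<in>stirling_perms n. x ^ s \<sigma> * y ^ t \<sigma>)"

end

theory Submission
  imports Defs "HOL-Library.FuncSet" "HOL-Library.Sublist"
    "HOL-Combinatorics.Transposition"
begin

text \<open>
  In a Stirling permutation the letters lying between the two copies of a letter \<open>v\<close> are larger
  than \<open>v\<close>. Hence \<open>v\<close> has three places where larger letters can sit next to its copies: directly
  before the first copy, between the copies, and directly after the second one. Splitting a word
  at the two copies of its smallest letter, and recursively splitting the three pieces, turns
  Stirling permutations of order \<open>n\<close> into increasing ternary trees with label set \<open>{1..n}\<close>
  (\<open>bij_betw_word\<close>): the three children of \<open>v\<close> are the blocks of larger letters in its three places.

  A letter belongs to \<open>Asc\<close>, \<open>Plat\<close> or \<open>Des\<close> iff its first, second or third child, respectively,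
  is missing (\<open>gap_letters_word\<close>). Each of the other six statistics says that one child of \<open>v\<close> is
  missing and another one is present; for example \<open>Dasc = Asc - Plat\<close> and \<open>Uu = Asc - Des\<close>.
  So each of the six pairs arises from an ordered pair \<open>(s, s')\<close> of distinct slots, as
  the set of nodes lacking child \<open>s\<close>, together with its subset of nodes having child \<open>s'\<close>.
  Permuting the children of all nodes at once by one permutation of the three slots is a bijection
  on increasing trees, and the permutations of a set act transitively on its ordered pairs
  of distinct elements. This gives the equidistribution, and summing over the possible
  values of the two sets gives the identities of generating functions.
\<close>

section \<open>Increasing ternary trees\<close>

datatype slot = Before | Between | After

text \<open>
  The children form a function of the slot, so that permuting them is composition with
  a permutation of the slots.
\<close>

datatype tree = Leaf | Node nat "slot \<Rightarrow> tree"

primrec labels :: "tree \<Rightarrow> nat set" where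
  "labels Leaf = {}"
| "labels (Node v c) = insert v (\<Union>s. labels (c s))"

primrec increasing :: "tree \<Rightarrow> bool" where
  "increasing Leaf \<longleftrightarrow> True"
| "increasing (Node v c) \<longleftrightarrow>
     (\<forall>s. increasing (c s)) \<and> (\<forall>s. \<forall>u\<in>labels (c s). v < u) \<and>
     (\<forall>s s'. s \<noteq> s' \<longrightarrow> labels (c s) \<inter> labels (c s') = {})"

primrec vacant :: "slot \<Rightarrow> tree \<Rightarrow> nat set" where
  "vacant s Leaf = {}"
| "vacant s (Node v c) = (if c s = Leaf then {v} else {}) \<union> (\<Union>s'. vacant s (c s'))"

primrec permute_children :: "(slot \<Rightarrow> slot) \<Rightarrow> tree \<Rightarrow> tree" where
  "permute_children p Leaf = Leaf"
| "permute_children p (Node v c) = Node v (\<lambda>s. permute_children p (c (p s)))"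

primrec word :: "tree \<Rightarrow> nat list" where
  "word Leaf = []"
| "word (Node v c) = word (c Before) @ v # word (c Between) @ v # word (c After)"

definition increasing_trees :: "nat \<Rightarrow> tree set" where
  "increasing_trees n = {t. increasing t \<and> labels t = {1..n}}"

lemma UN_slot: "(\<Union>s. f s) = f Before \<union> f Between \<union> f After"
proof -
  have slots: "(UNIV :: slot set) = {Before, Between, After}"
    using slot.exhaust by auto
  show ?thesis unfolding slots by auto
qed

lemma all_slot: "(\<forall>s. P s) \<longleftrightarrow> P Before \<and> P Between \<and> P After"
  by (metis slot.exhaust)

lemma set_word: "set (word t) = labels t"
  by (induction t) (auto simp: UN_slot)

section \<open>Permuting the children\<close>

lemma permute_children_eq_Leaf_iff [simp]: "permute_children p t = Leaf \<longleftrightarrow> t = Leaf"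
  by (cases t) auto

lemma labels_permute_children:
  assumes "surj p"
  shows "labels (permute_children p t) = labels t"
proof (induction t)
  case (Node v c)
  have "(\<Union>s. labels (c (p s))) = (\<Union>s\<in>range p. labels (c s))" by auto
  with Node assms show ?case by simp
qed simp

lemma vacant_permute_children:
  assumes "surj p"
  shows "vacant s (permute_children p t) = vacant (p s) t"
proof (induction t)
  case (Node v c)
  have "(\<Union>s'. vacant (p s) (c (p s'))) = (\<Union>s'\<in>range p. vacant (p s) (c s'))" by auto
  with Node assms show ?case by simp
qed simp

lemma increasing_permute_children:
  assumes "bij p" "increasing t"
  shows "increasing (permute_children p t)"
  using assms(2)
  by (induction t)
     (auto simp: labels_permute_children [OF bij_is_surj [OF assms(1)]]
        inj_eq [OF bij_is_inj [OF assms(1)]])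

lemma permute_children_inverse:
  assumes "\<And>s. q (p s) = s"
  shows "permute_children p (permute_children q t) = t"
  by (induction t) (auto simp: assms)

lemma bij_betw_permute_children:
  assumes "bij p"
  shows "bij_betw (permute_children p) (increasing_trees n) (increasing_trees n)"
proof (rule bij_betwI)
  have closed: "permute_children q \<in> increasing_trees n \<rightarrow> increasing_trees n" if "bij q" for q
    using that
    by (auto simp: increasing_trees_def increasing_permute_children
        labels_permute_children bij_is_surj)
  show "permute_children p \<in> increasing_trees n \<rightarrow> increasing_trees n"
    by (rule closed [OF assms])
  show "permute_children (inv p) \<in> increasing_trees n \<rightarrow> increasing_trees n"
    by (rule closed [OF bij_imp_bij_inv [OF assms]])
  show "permute_children (inv p) (permute_children p t) = t" for t
    by (rule permute_children_inverse) (simp add: surj_f_inv_f bij_is_surj assms)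
  show "permute_children p (permute_children (inv p) t) = t" for t
    by (rule permute_children_inverse) (simp add: inv_f_f bij_is_inj assms)
qed

lemma bij_extending_distinct_pair:
  fixes s s' u u' :: 'a
  assumes "s \<noteq> s'" "u \<noteq> u'"
  obtains p where "bij p" "p s = u" "p s' = u'"
proof -
  define w where "w = Transposition.transpose s u s'"
  define p where "p = Transposition.transpose w u' \<circ> Transposition.transpose s u"
  have "w \<noteq> u"
    using assms(1) by (auto simp: w_def Transposition.transpose_def split: if_splits)
  then have "p s = u" "p s' = u'"
    using assms(2) by (simp_all add: p_def w_def [symmetric] transpose_apply_other)
  moreover have "bij p" by (simp add: p_def bij_comp)
  ultimately show thesis using that by blast
qed

section \<open>Stirling words and trees\<close>

text \<open>
  Forbidding the subwords \<open>a b a\<close> with \<open>b < a\<close> avoids positions, so that the condition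
  passes to the pieces of a word by transitivity of the subword relation.
\<close>

definition stirling :: "nat list \<Rightarrow> bool" where
  "stirling w \<longleftrightarrow> (\<forall>a b. subseq [a, b, a] w \<longrightarrow> a \<le> b)"

lemma subseq_nth_Cons:
  assumes "i < length w" "subseq ys (drop (Suc i) w)"
  shows "subseq (w ! i # ys) w"
proof -
  have "subseq (w ! i # ys) (w ! i # drop (Suc i) w)" using assms(2) by simp
  then have "subseq (w ! i # ys) (take i w @ w ! i # drop (Suc i) w)"
    by (rule list_emb_append2)
  with assms(1) show ?thesis by (simp add: id_take_nth_drop [symmetric])
qed

lemma subseq_Cons_nthE:
  assumes "subseq (x # ys) w"
  obtains i where "i < length w" "w ! i = x" "subseq ys (drop (Suc i) w)"
proof -
  from list_emb_ConsD [OF assms] obtain us vs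
    where "w = us @ x # vs" "subseq ys vs" by auto
  then show thesis using that [of "length us"] by simp
qed

lemma stirling_iff_nth:
  "stirling w \<longleftrightarrow>
     (\<forall>i s j. i < s \<and> s < j \<and> j < length w \<and> w ! i = w ! j \<longrightarrow> w ! i \<le> w ! s)"
proof (intro iffI allI impI)
  fix i s j assume st: "stirling w"
    and ij: "i < s \<and> s < j \<and> j < length w \<and> w ! i = w ! j"
  have "subseq [w ! j] (drop (Suc s) w)"
    using subseq_nth_Cons [of "j - Suc s" "drop (Suc s) w" "[]"] ij
    by (simp add: diff_less_mono Suc_le_eq)
  then have "subseq [w ! s, w ! j] (drop (Suc i) w)"
    using subseq_nth_Cons [of "s - Suc i" "drop (Suc i) w" "[w ! j]"] ij
    by (simp add: diff_less_mono Suc_le_eq)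
  then have "subseq [w ! i, w ! s, w ! j] w"
    using subseq_nth_Cons [of i w] ij by simp
  with st ij show "w ! i \<le> w ! s" by (simp add: stirling_def)
next
  assume nth: "\<forall>i s j. i < s \<and> s < j \<and> j < length w \<and> w ! i = w ! j \<longrightarrow> w ! i \<le> w ! s"
  show "stirling w" unfolding stirling_def
  proof (intro allI impI)
    fix a b assume "subseq [a, b, a] w"
    then obtain i where i: "i < length w" "w ! i = a" "subseq [b, a] (drop (Suc i) w)"
      by (rule subseq_Cons_nthE)
    from i(3) obtain k where k: "k < length (drop (Suc i) w)" "drop (Suc i) w ! k = b"
      "subseq [a] (drop (Suc k) (drop (Suc i) w))"
      by (rule subseq_Cons_nthE)
    from k(3) obtain l where l: "l < length (drop (Suc k) (drop (Suc i) w))"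
      "drop (Suc k) (drop (Suc i) w) ! l = a"
      by (rule subseq_Cons_nthE)
    show "a \<le> b"
      using nth [rule_format, of i "Suc i + k" "Suc i + (Suc k + l)"] i k l
      by (simp add: ac_simps)
  qed
qed

lemma letter_nth: "i \<in> positions w \<Longrightarrow> letter w i = w ! (i - 1)"
  by (auto simp: letter_def positions_def nth_append nth_Cons')

lemma stirling_perms_iff:
  "w \<in> stirling_perms n \<longleftrightarrow>
     stirling w \<and> (\<forall>v. count (mset w) v = (if v \<in> {1..n} then 2 else 0))"
proof -
  have "mset w = mset_set {1..n} + mset_set {1..n} \<longleftrightarrow>
      (\<forall>v. count (mset w) v = (if v \<in> {1..n} then 2 else 0))"
    by (auto simp: multiset_eq_iff count_mset_set')
  moreover have "(\<forall>i\<in>positions w. \<forall>s\<in>positions w. \<forall>j\<in>positions w.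
      i < s \<and> s < j \<and> letter w i = letter w j \<longrightarrow> letter w s \<ge> letter w i) \<longleftrightarrow> stirling w"
    (is "?L \<longleftrightarrow> _")
  proof
    assume L: ?L
    show "stirling w" unfolding stirling_iff_nth
    proof (intro allI impI)
      fix i s j assume "i < s \<and> s < j \<and> j < length w \<and> w ! i = w ! j"
      then show "w ! i \<le> w ! s"
        using L [rule_format, of "Suc i" "Suc s" "Suc j"]
        by (auto simp: positions_def letter_def nth_append)
    qed
  next
    assume st: "stirling w"
    show ?L
    proof (intro ballI impI)
      fix i s j assume *: "i \<in> positions w" "s \<in> positions w" "j \<in> positions w"
        "i < s \<and> s < j \<and> letter w i = letter w j"
      then show "letter w i \<le> letter w s"
        using st [unfolded stirling_iff_nth, rule_format, of "i - 1" "s - 1" "j - 1"]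
        by (auto simp: positions_def letter_nth diff_less_mono)
    qed
  qed
  ultimately show ?thesis unfolding stirling_perms_def by blast
qed

lemma set_subseq: "subseq xs ys \<Longrightarrow> set xs \<subseteq> set ys"
  by (auto elim: list_emb_set)

lemma subseq_split:
  assumes "subseq [u, b, u] (p @ v # q)" "u \<noteq> v" "set p \<inter> set q = {}"
  shows "subseq [u, b, u] p \<or> subseq [u, b, u] q"
  using assms(1)
proof (cases rule: subseq_appendE)
  case (append xs ys)
  have "set xs \<subseteq> set p" "set ys \<subseteq> insert v (set q)"
    using set_subseq [OF append(2)] set_subseq [OF append(3)] by auto
  then have "ys = [] \<or> xs = []"
    using append(1) assms(2,3) by (auto simp: Cons_eq_append_conv)
  then show ?thesis using append assms(2) by (auto simp: subseq_Cons2_neq)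
qed

text \<open>
  In a subword \<open>u b u\<close> with \<open>u \<noteq> v\<close>, both copies of \<open>u\<close> lie in the same one of the three pieces,
  because the pieces have no letters in common, and hence \<open>b\<close> lies in that piece too.
\<close>

lemma stirling_join:
  assumes st: "stirling l" "stirling m" "stirling r"
    and gt: "\<forall>u\<in>set l \<union> set m \<union> set r. v < u"
    and dj: "set l \<inter> set m = {}" "set l \<inter> set r = {}" "set m \<inter> set r = {}"
  shows "stirling (l @ v # m @ v # r)"
  unfolding stirling_def
proof (intro allI impI)
  fix u b assume sub: "subseq [u, b, u] (l @ v # m @ v # r)"
  then have sets: "{u, b} \<subseteq> set (l @ v # m @ v # r)"
    using set_subseq by fastforce
  show "u \<le> b"
  proof (cases "u = v")
    case True
    with sets gt show ?thesis by (auto intro: less_imp_le)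
  next
    case False
    have "set l \<inter> set (m @ v # r) = {}" using dj gt by auto
    with sub False have "subseq [u, b, u] l \<or> subseq [u, b, u] (m @ v # r)"
      by (rule subseq_split)
    then have "subseq [u, b, u] l \<or> subseq [u, b, u] m \<or> subseq [u, b, u] r"
      using subseq_split [of u b m v r] False dj(3) by blast
    with st show ?thesis by (auto simp: stirling_def)
  qed
qed

lemma stirling_subseq: "stirling w \<Longrightarrow> subseq w' w \<Longrightarrow> stirling w'"
  by (meson stirling_def subseq_order.trans)

lemma stirling_word: "increasing t \<Longrightarrow> stirling (word t)"
proof (induction t)
  case Leaf
  then show ?case by (simp add: stirling_def)
next
  case (Node v c)
  then have "labels (c s) \<inter> labels (c s') = {}" if "s \<noteq> s'" for s s'
    using that by simp
  moreover have "stirling (word (c s))" "\<forall>u\<in>labels (c s). v < u" for s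
    using Node by simp_all
  ultimately show ?case
    unfolding word.simps by (intro stirling_join) (simp_all add: set_word ball_Un)
qed

lemma count_word:
  "increasing t \<Longrightarrow> count (mset (word t)) v = (if v \<in> labels t then 2 else 0)"
proof (induction t)
  case (Node u c)
  have dj: "labels (c Before) \<inter> labels (c Between) = {}"
    "labels (c Before) \<inter> labels (c After) = {}" "labels (c Between) \<inter> labels (c After) = {}"
    and root: "u \<notin> labels (c s)" for s
    using Node.prems by auto
  have "count (mset (word (c s))) v = (if v \<in> labels (c s) then 2 else 0)" for s
    using Node by simp
  then show ?case using dj root by (auto simp: UN_slot disjoint_iff)
qed simp

lemma append_Cons_eq_iff_first:
  assumes "x \<notin> set xs" "x \<notin> set xs'"
  shows "xs @ x # ys = xs' @ x # ys' \<longleftrightarrow> xs = xs' \<and> ys = ys'"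
  using assms by (auto simp: append_eq_append_conv2 Cons_eq_append_conv append_eq_Cons_conv)

text \<open>
  The root is the smallest letter of the word, so its two copies determine the cuts.
\<close>

lemma word_inject:
  "increasing t \<Longrightarrow> increasing t' \<Longrightarrow> word t = word t' \<Longrightarrow> t = t'"
proof (induction t arbitrary: t')
  case Leaf
  then show ?case by (cases t') auto
next
  case (Node v c)
  then obtain v' c' where t': "t' = Node v' c'" by (cases t') auto
  have root: "Min (labels (Node u d)) = u" if "increasing (Node u d)" for u d
  proof (rule Min_eqI)
    show "finite (labels (Node u d))" by (metis set_word List.finite_set)
    show "u \<le> x" if "x \<in> labels (Node u d)" for x
      using that \<open>increasing (Node u d)\<close> by force
  qed simp
  have "v' = v" using Node.prems root t' by (metis set_word)
  have notin: "v \<notin> set (word (c s))" "v \<notin> set (word (c' s))" for s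
    using Node.prems t' \<open>v' = v\<close> by (auto simp: set_word)
  have "word (c Before) = word (c' Before) \<and> word (c Between) = word (c' Between) \<and>
      word (c After) = word (c' After)"
    using Node.prems(3) notin by (simp add: t' \<open>v' = v\<close> append_Cons_eq_iff_first)
  then have "word (c s) = word (c' s)" for s by (cases s) auto
  then have "c s = c' s" for s using Node t' by auto
  then show ?case using t' \<open>v' = v\<close> by auto
qed

text \<open>
  Cutting at the two copies of the smallest letter leaves three shorter Stirling words; no letter
  is shared by two of them, so each still contains both copies of its letters.
\<close>

lemma ex_word:
  assumes "stirling w" "\<forall>v\<in>set w. count (mset w) v = 2"
  shows "\<exists>t. increasing t \<and> word t = w"
  using assms
proof (induction w rule: length_induct)
  case (1 w)
  show ?case
  proof (cases "w = []")
    case True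
    then show ?thesis by (intro exI [of _ Leaf]) simp
  next
    case False
    define v where "v = Min (set w)"
    have "v \<in> set w" and least: "\<And>u. u \<in> set w \<Longrightarrow> v \<le> u"
      using False by (auto simp: v_def)
    obtain l w' where w': "w = l @ v # w'" "v \<notin> set l"
      using split_list_first [OF \<open>v \<in> set w\<close>] by blast
    have "count (mset w) v = 2" using 1 \<open>v \<in> set w\<close> by blast
    then have "v \<in> set w'" using w'
      by (cases "v \<in> set w'") (simp_all add: count_mset_0_iff [THEN iffD2])
    then obtain m r where mr: "w' = m @ v # r" "v \<notin> set m"
      using split_list_first by metis
    have w: "w = l @ v # m @ v # r" using w' mr by simp
    have "v \<notin> set r" using \<open>count (mset w) v = 2\<close> w by (auto simp: count_eq_zero_iff)
    have gt: "v < u" if "u \<in> set l \<union> set m \<union> set r" for u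
      using that least [of u] w w' mr \<open>v \<notin> set r\<close> by (auto simp: le_less)
    \<comment> \<open>A letter occurring in two pieces would enclose a copy of the smaller letter \<open>v\<close>.\<close>
    have enclosed: "x \<notin> set q" if "subseq (p @ v # q) w" "x \<in> set p" "v < x" for x p q
    proof
      assume "x \<in> set q"
      with that(2) have "subseq ([x] @ [v] @ [x]) (p @ [v] @ q)"
        by (intro list_emb_append_mono) (auto simp: subseq_singleton_left)
      then have "subseq [x, v, x] w" using that(1) by (auto intro: subseq_order.trans)
      with 1 have "x \<le> v" by (auto simp: stirling_def)
      with that(3) show False by simp
    qed
    have subs: "subseq (l @ v # m) w" "subseq (l @ v # r) w" "subseq (m @ v # r) w"
      unfolding w by (auto simp: subseq_append' intro: subseq_rev_drop_many subseq_drop_many)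
    have dj: "set l \<inter> set m = {}" "set l \<inter> set r = {}" "set m \<inter> set r = {}"
      using enclosed [OF subs(1)] enclosed [OF subs(2)] enclosed [OF subs(3)] gt by blast+
    have piece: "\<exists>t. increasing t \<and> word t = p" if "p \<in> {l, m, r}" for p
    proof -
      have "length p < length w" using that w by auto
      moreover have "stirling p"
        using that 1 w by (auto intro!: stirling_subseq [of w])
      moreover have "count (mset p) u = 2" if u: "u \<in> set p" for u
      proof -
        have "u \<in> set w" using u \<open>p \<in> {l, m, r}\<close> w by auto
        then have "count (mset w) u = 2" using 1 by blast
        moreover have "u \<noteq> v" using gt u \<open>p \<in> {l, m, r}\<close> by blast
        moreover have "(p = l \<longrightarrow> u \<notin> set m \<and> u \<notin> set r) \<and> (p = m \<longrightarrow> u \<notin> set l \<and> u \<notin> set r) \<and>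
            (p = r \<longrightarrow> u \<notin> set l \<and> u \<notin> set m)"
          using u dj by blast
        ultimately show ?thesis
          using \<open>p \<in> {l, m, r}\<close> by (auto simp: w count_mset_0_iff [THEN iffD2])
      qed
      ultimately show ?thesis using 1 by blast
    qed
    obtain tl where tl: "increasing tl" "word tl = l" using piece [of l] by auto
    obtain tm where tm: "increasing tm" "word tm = m" using piece [of m] by auto
    obtain tr where tr: "increasing tr" "word tr = r" using piece [of r] by auto
    note t = tl tm tr
    define c where "c s = (case s of Before \<Rightarrow> tl | Between \<Rightarrow> tm | After \<Rightarrow> tr)" for s
    have "labels tl = set l" "labels tm = set m" "labels tr = set r"
      using t set_word by metis+
    then have "increasing (Node v c)"
      using t dj gt by (auto simp: c_def all_slot)
    moreover have "word (Node v c) = w" using t w by (simp add: c_def)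
    ultimately show ?thesis by blast
  qed
qed

lemma bij_betw_word: "bij_betw word (increasing_trees n) (stirling_perms n)"
  unfolding bij_betw_def
proof (intro conjI equalityI subsetI)
  show "inj_on word (increasing_trees n)"
    by (auto simp: inj_on_def increasing_trees_def intro: word_inject)
next
  fix w assume "w \<in> word ` increasing_trees n"
  then show "w \<in> stirling_perms n"
    by (auto simp: stirling_perms_iff increasing_trees_def set_word stirling_word count_word)
next
  fix w assume w: "w \<in> stirling_perms n"
  then have cnt: "count (mset w) v = (if v \<in> {1..n} then 2 else 0)" for v
    by (simp add: stirling_perms_iff)
  have "set w = {1..n}"
    using cnt by (metis (no_types, lifting) count_mset_0_iff set_eqI zero_neq_numeral)
  then obtain t where "increasing t" "word t = w"
    using ex_word [of w] w cnt by (auto simp: stirling_perms_iff)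
  then show "w \<in> word ` increasing_trees n"
    using \<open>set w = {1..n}\<close> set_word by (force simp: increasing_trees_def)
qed

section \<open>Vacant slots as gaps of the word\<close>

text \<open>
  A pair of adjacent letters \<open>x y\<close> is a place where a larger letter could be inserted;
  it witnesses a vacant slot of the larger of the two letters (of their common value if they
  are equal), and which slot is vacant depends on the comparison.
\<close>

fun gap_letter :: "slot \<Rightarrow> nat \<Rightarrow> nat \<Rightarrow> nat set" where
  "gap_letter Before x y = (if x < y then {y} else {})"
| "gap_letter Between x y = (if x = y then {x} else {})"
| "gap_letter After x y = (if x > y then {x} else {})"

fun gap_letters :: "slot \<Rightarrow> nat list \<Rightarrow> nat set" where
  "gap_letters s (x # y # w) = gap_letter s x y \<union> gap_letters s (y # w)"
| "gap_letters s _ = {}"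

lemma gap_letters_split:
  "gap_letters s (xs @ y # ys) = gap_letters s (xs @ [y]) \<union> gap_letters s (y # ys)"
proof (induction xs)
  case (Cons x xs)
  then show ?case by (cases xs) auto
qed simp

lemma gap_letters_nth:
  "gap_letters s w = (\<Union>i\<in>{..<length w - 1}. gap_letter s (w ! i) (w ! Suc i))"
proof (induction s w rule: gap_letters.induct)
  case (1 s x y w)
  then show ?case by (simp add: lessThan_Suc_eq_insert_0 del: gap_letter.simps)
qed auto

text \<open>
  The boundary letters of the three subtrees are the root letter and the outer boundary
  letters, hence the induction needs arbitrary boundary letters. A vacant slot of the root
  is a gap formed by two of these boundary letters.
\<close>

lemma gap_letters_word:
  assumes "increasing t" "\<forall>u\<in>labels t. a < u \<and> b < u"
  shows "gap_letters s (a # word t @ [b]) = (if t = Leaf then gap_letter s a b else vacant s t)"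
  using assms
proof (induction t arbitrary: a b)
  case (Node v c)
  let ?gap = "\<lambda>t a b. if t = Leaf then gap_letter s a b else vacant s t"
  have ab: "a < v" "b < v" using Node.prems by auto
  have below: "\<forall>u\<in>labels (c s). v < u \<and> a < u \<and> b < u" for s
    using Node.prems by auto
  have IH: "gap_letters s (x # word (c s') @ [y]) = ?gap (c s') x y"
    if "x \<in> {a, b, v}" "y \<in> {a, b, v}" for s' x y
    using Node.IH [of "c s'" x y] Node.prems(1) below [of s'] that by auto
  have "gap_letters s (a # word (Node v c) @ [b]) =
      gap_letters s (a # word (c Before) @ [v]) \<union>
      (gap_letters s (v # word (c Between) @ [v]) \<union> gap_letters s (v # word (c After) @ [b]))"
    using gap_letters_split [of s "a # word (c Before)" v "word (c Between) @ v # word (c After) @ [b]"]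
      gap_letters_split [of s "v # word (c Between)" v "word (c After) @ [b]"]
    by simp
  also have "\<dots> = ?gap (c Before) a v \<union> (?gap (c Between) v v \<union> ?gap (c After) v b)"
    by (simp add: IH del: gap_letter.simps)
  also have "\<dots> = vacant s (Node v c)"
    using ab by (cases s) (auto simp: UN_slot)
  finally show ?case by simp
qed simp

abbreviation slot_letters :: "slot \<Rightarrow> nat list \<Rightarrow> nat set" where
  "slot_letters s \<sigma> \<equiv> gap_letters s (0 # \<sigma> @ [0])"

lemma slot_letters_letter:
  "slot_letters s \<sigma> = (\<Union>i\<in>{..length \<sigma>}. gap_letter s (letter \<sigma> i) (letter \<sigma> (Suc i)))"
  by (simp add: gap_letters_nth letter_def lessThan_Suc_atMost del: gap_letter.simps)

lemma slot_letters_word: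
  assumes "n \<ge> 1" "t \<in> increasing_trees n"
  shows "slot_letters s (word t) = vacant s t"
  using assms gap_letters_word [of t 0 0 s] by (auto simp: increasing_trees_def)

lemma letter_0 [simp]: "letter \<sigma> 0 = 0" and letter_end [simp]: "letter \<sigma> (Suc (length \<sigma>)) = 0"
  by (simp_all add: letter_def nth_append)

lemma set_stirling_perm:
  assumes "\<sigma> \<in> stirling_perms n"
  shows "set \<sigma> = {1..n}"
proof -
  have "v \<in> set \<sigma> \<longleftrightarrow> v \<in> {1..n}" for v
    using assms count_mset_0_iff [of \<sigma> v] by (simp add: stirling_perms_iff split: if_splits)
  then show ?thesis by blast
qed

lemma letter_in_range:
  assumes "\<sigma> \<in> stirling_perms n" "i \<in> positions \<sigma>"
  shows "letter \<sigma> i \<in> {1..n}"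
proof -
  have "letter \<sigma> i = \<sigma> ! (i - 1)" "i - 1 < length \<sigma>"
    using assms(2) by (auto simp: letter_nth positions_def)
  then show ?thesis using set_stirling_perm [OF assms(1)] nth_mem by metis
qed

lemma Asc_eq_slot_letters: "Asc \<sigma> = slot_letters Before \<sigma>"
proof (intro equalityI subsetI)
  fix v assume "v \<in> Asc \<sigma>"
  then obtain i where "i \<in> positions \<sigma>" "letter \<sigma> (i - 1) < letter \<sigma> i" "v = letter \<sigma> i"
    by (auto simp: Asc_def)
  then show "v \<in> slot_letters Before \<sigma>"
    unfolding slot_letters_letter by (intro UN_I [of "i - 1"]) (auto simp: positions_def)
next
  fix v assume "v \<in> slot_letters Before \<sigma>"
  then obtain i where i: "i \<le> length \<sigma>" "letter \<sigma> i < letter \<sigma> (Suc i)" "v = letter \<sigma> (Suc i)"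
    by (auto simp: slot_letters_letter split: if_splits)
  then have "i \<noteq> length \<sigma>" by (metis letter_end not_less_zero)
  with i show "v \<in> Asc \<sigma>"
    unfolding Asc_def by (intro CollectI exI [of _ "Suc i"]) (auto simp: positions_def)
qed

lemma Des_eq_slot_letters: "Des \<sigma> = slot_letters After \<sigma>"
proof (intro equalityI subsetI)
  fix v assume "v \<in> Des \<sigma>"
  then show "v \<in> slot_letters After \<sigma>"
    by (force simp: Des_def slot_letters_letter positions_def)
next
  fix v assume "v \<in> slot_letters After \<sigma>"
  then obtain i where i: "i \<le> length \<sigma>" "letter \<sigma> i > letter \<sigma> (Suc i)" "v = letter \<sigma> i"
    by (auto simp: slot_letters_letter split: if_splits)
  then have "i \<noteq> 0" by (metis letter_0 not_less_zero)
  with i show "v \<in> Des \<sigma>"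
    unfolding Des_def by (intro CollectI exI [of _ i]) (auto simp: positions_def)
qed

lemma Plat_eq_slot_letters:
  assumes "\<sigma> \<in> stirling_perms n" "n \<ge> 1"
  shows "Plat \<sigma> = slot_letters Between \<sigma>"
proof (intro equalityI subsetI)
  fix v assume "v \<in> Plat \<sigma>"
  then show "v \<in> slot_letters Between \<sigma>"
    by (force simp: Plat_def slot_letters_letter positions_def)
next
  fix v assume "v \<in> slot_letters Between \<sigma>"
  then obtain i where i: "i \<le> length \<sigma>" "letter \<sigma> i = letter \<sigma> (Suc i)" "v = letter \<sigma> i"
    by (auto simp: slot_letters_letter split: if_splits)
  \<comment> \<open>In the empty word, the two boundary zeros would form a plateau.\<close>
  have "\<sigma> \<noteq> []" using set_stirling_perm [OF assms(1)] assms(2) by auto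
  then have "letter \<sigma> 1 \<in> {1..n}"
    using letter_in_range [OF assms(1), of 1] by (cases \<sigma>) (auto simp: positions_def)
  then have "i \<noteq> 0" using i by (cases i) auto
  with i show "v \<in> Plat \<sigma>"
    unfolding Plat_def by (intro CollectI exI [of _ i]) (auto simp: positions_def)
qed

section \<open>The six refined statistics as differences\<close>

lemma two_copiesE:
  assumes Q: "\<sigma> \<in> stirling_perms n" and v: "v \<in> {1..n}"
  obtains i j where "i < j" "\<forall>k. k \<in> positions \<sigma> \<and> letter \<sigma> k = v \<longleftrightarrow> k = i \<or> k = j"
    "letter \<sigma> (i - 1) \<noteq> v" "v \<le> letter \<sigma> (i + 1)" "letter \<sigma> (i + 1) = v \<longleftrightarrow> j = i + 1"
    "letter \<sigma> (j + 1) \<noteq> v" "v \<le> letter \<sigma> (j - 1)" "letter \<sigma> (j - 1) = v \<longleftrightarrow> j = i + 1"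
proof -
  let ?K = "{k. k \<in> positions \<sigma> \<and> letter \<sigma> k = v}"
  have "?K = Suc ` {k. k < length \<sigma> \<and> \<sigma> ! k = v}"
    by (force simp: positions_def letter_def nth_append image_iff Suc_le_eq gr0_conv_Suc)
  then have "card ?K = count (mset \<sigma>) v"
    by (simp add: card_image count_mset count_list_eq_length_filter length_filter_conv_card
        eq_commute [of v])
  also have "\<dots> = 2" using Q v by (simp add: stirling_perms_iff)
  finally obtain a b where "?K = {a, b}" "a \<noteq> b" by (auto simp: card_2_iff)
  then obtain i j where "i < j" and K: "?K = {i, j}"
    by (metis insert_commute linorder_neqE_nat)
  have iff: "k \<in> positions \<sigma> \<and> letter \<sigma> k = v \<longleftrightarrow> k = i \<or> k = j" for k
    using K by blast
  have ij: "i \<in> positions \<sigma>" "letter \<sigma> i = v" "j \<in> positions \<sigma>" "letter \<sigma> j = v"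
    using iff by blast+
  have between: "v \<le> letter \<sigma> k" if "i \<le> k" "k \<le> j" for k
  proof (cases "k = i \<or> k = j")
    case False
    then have "i < k" "k < j" "k \<in> positions \<sigma>" using that ij by (auto simp: positions_def)
    moreover have "\<forall>i\<in>positions \<sigma>. \<forall>s\<in>positions \<sigma>. \<forall>j\<in>positions \<sigma>.
        i < s \<and> s < j \<and> letter \<sigma> i = letter \<sigma> j \<longrightarrow> letter \<sigma> i \<le> letter \<sigma> s"
      using Q by (simp add: stirling_perms_def)
    ultimately show ?thesis using ij by metis
  qed (use ij in auto)
  have outer: "k = i \<or> k = j" if "letter \<sigma> k = v" "k \<le> Suc (length \<sigma>)" for k
  proof -
    have "k \<noteq> 0" "k \<noteq> Suc (length \<sigma>)" using that v by (auto intro!: gr0I)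
    with that show ?thesis using iff [of k] by (auto simp: positions_def)
  qed
  have bounds: "i - 1 < i" "i - 1 \<le> Suc (length \<sigma>)" "j - 1 < j" "j - 1 \<le> Suc (length \<sigma>)"
    using ij by (auto simp: positions_def)
  show thesis
  proof (rule that [OF \<open>i < j\<close> allI [OF iff]])
    show "letter \<sigma> (i - 1) \<noteq> v" "letter \<sigma> (j + 1) \<noteq> v"
      using outer [of "i - 1"] outer [of "j + 1"] \<open>i < j\<close> ij bounds
      by (auto simp: positions_def)
    show "v \<le> letter \<sigma> (i + 1)" "v \<le> letter \<sigma> (j - 1)"
      using \<open>i < j\<close> by (auto intro: between)
    show "letter \<sigma> (i + 1) = v \<longleftrightarrow> j = i + 1" "letter \<sigma> (j - 1) = v \<longleftrightarrow> j = i + 1"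
      using outer [of "i + 1"] outer [of "j - 1"] \<open>i < j\<close> ij bounds
      by (auto simp: positions_def)
  qed
qed

text \<open>
  Let \<open>i < j\<close> be the positions of the two copies of \<open>v\<close>. Both \<open>letter \<sigma> (i + 1)\<close> and
  \<open>letter \<sigma> (j - 1)\<close> are at least \<open>v\<close>, with equality only at a plateau, whereas
  \<open>letter \<sigma> (i - 1)\<close> and \<open>letter \<sigma> (j + 1)\<close> differ from \<open>v\<close>. So every condition on the
  neighbours of a copy of \<open>v\<close> is a conjunction of conditions that \<open>v\<close> is or is not in
  \<open>Asc\<close>, \<open>Plat\<close> and \<open>Des\<close>.
\<close>

lemma refined_statistics_eq_Diff:
  assumes Q: "\<sigma> \<in> stirling_perms n"
  shows "Dasc \<sigma> = Asc \<sigma> - Plat \<sigma>" "Uu \<sigma> = Asc \<sigma> - Des \<sigma>"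
    "Dplat \<sigma> = Plat \<sigma> - Asc \<sigma>" "Pasc \<sigma> = Plat \<sigma> - Des \<sigma>"
    "Ddes \<sigma> = Des \<sigma> - Plat \<sigma>" "Dd \<sigma> = Des \<sigma> - Asc \<sigma>"
proof -
  let ?stats = "{Asc \<sigma>, Plat \<sigma>, Des \<sigma>, Dasc \<sigma>, Uu \<sigma>, Dplat \<sigma>, Pasc \<sigma>, Ddes \<sigma>, Dd \<sigma>}"
  have range: "S \<subseteq> {1..n}" if "S \<in> ?stats" for S
  proof -
    have "S \<subseteq> letter \<sigma> ` positions \<sigma>"
      using that by (auto simp: Asc_def Plat_def Des_def Dasc_def Uu_def Dplat_def Pasc_def
          Ddes_def Dd_def)
    then show ?thesis using letter_in_range [OF Q] by blast
  qed
  have eqI: "S = T - U"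
    if "S \<in> ?stats" "T \<in> ?stats" "\<And>v. v \<in> {1..n} \<Longrightarrow> v \<in> S \<longleftrightarrow> v \<in> T - U" for S T U
    using range [OF that(1)] range [OF that(2)] that(3) by blast
  have *: "(v \<in> Dasc \<sigma> \<longleftrightarrow> v \<in> Asc \<sigma> - Plat \<sigma>) \<and> (v \<in> Uu \<sigma> \<longleftrightarrow> v \<in> Asc \<sigma> - Des \<sigma>) \<and>
    (v \<in> Dplat \<sigma> \<longleftrightarrow> v \<in> Plat \<sigma> - Asc \<sigma>) \<and> (v \<in> Pasc \<sigma> \<longleftrightarrow> v \<in> Plat \<sigma> - Des \<sigma>) \<and>
    (v \<in> Ddes \<sigma> \<longleftrightarrow> v \<in> Des \<sigma> - Plat \<sigma>) \<and> (v \<in> Dd \<sigma> \<longleftrightarrow> v \<in> Des \<sigma> - Asc \<sigma>)"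
    if "v \<in> {1..n}" for v
  proof -
    obtain i j where "i < j" and iff: "\<forall>k. k \<in> positions \<sigma> \<and> letter \<sigma> k = v \<longleftrightarrow> k = i \<or> k = j"
      and nb: "letter \<sigma> (i - 1) \<noteq> v" "v \<le> letter \<sigma> (i + 1)" "letter \<sigma> (i + 1) = v \<longleftrightarrow> j = i + 1"
      "letter \<sigma> (j + 1) \<noteq> v" "v \<le> letter \<sigma> (j - 1)" "letter \<sigma> (j - 1) = v \<longleftrightarrow> j = i + 1"
      using two_copiesE [OF Q \<open>v \<in> {1..n}\<close>] .
    have ij: "i \<in> positions \<sigma>" "letter \<sigma> i = v" "j \<in> positions \<sigma>" "letter \<sigma> j = v"
      using iff by blast+
    have ex: "v \<in> {letter \<sigma> k |k. k \<in> positions \<sigma> \<and> R k} \<longleftrightarrow> R i \<or> R j" for R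
      unfolding mem_Collect_eq using iff by metis
    have ex2: "(\<exists>l\<in>positions \<sigma>. k < l \<and> R \<and> letter \<sigma> k = letter \<sigma> l \<and> R' l) \<longleftrightarrow>
        k < i \<and> R \<and> R' i \<or> k < j \<and> R \<and> R' j" if "letter \<sigma> k = v" for k R R'
      using iff that by metis
    have mem:
      "v \<in> Asc \<sigma> \<longleftrightarrow> letter \<sigma> (i - 1) < v"
      "v \<in> Plat \<sigma> \<longleftrightarrow> j = i + 1"
      "v \<in> Des \<sigma> \<longleftrightarrow> letter \<sigma> (j + 1) < v"
      "v \<in> Dasc \<sigma> \<longleftrightarrow> letter \<sigma> (i - 1) < v \<and> j \<noteq> i + 1"
      "v \<in> Dplat \<sigma> \<longleftrightarrow> letter \<sigma> (i - 1) > v \<and> j = i + 1"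
      "v \<in> Ddes \<sigma> \<longleftrightarrow> j \<noteq> i + 1 \<and> letter \<sigma> (j + 1) < v"
      "v \<in> Pasc \<sigma> \<longleftrightarrow> j = i + 1 \<and> letter \<sigma> (j + 1) > v"
      unfolding Asc_def Plat_def Des_def Dasc_def Dplat_def Ddes_def Pasc_def ex
      using ij nb by auto
    have mem2:
      "v \<in> Uu \<sigma> \<longleftrightarrow> letter \<sigma> (i - 1) < v \<and> letter \<sigma> (j + 1) > v"
      "v \<in> Dd \<sigma> \<longleftrightarrow> letter \<sigma> (i - 1) > v \<and> letter \<sigma> (j + 1) < v"
      unfolding Uu_def Dd_def ex ex2 [OF ij(2)] ex2 [OF ij(4)]
      using ij \<open>i < j\<close> by auto
    show ?thesis unfolding Diff_iff mem mem2 using nb by auto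
  qed
  show "Dasc \<sigma> = Asc \<sigma> - Plat \<sigma>" "Uu \<sigma> = Asc \<sigma> - Des \<sigma>"
    "Dplat \<sigma> = Plat \<sigma> - Asc \<sigma>" "Pasc \<sigma> = Plat \<sigma> - Des \<sigma>"
    "Ddes \<sigma> = Des \<sigma> - Plat \<sigma>" "Dd \<sigma> = Des \<sigma> - Asc \<sigma>"
    by (rule eqI; simp add: *)+
qed

section \<open>Equidistribution\<close>

definition slot_pair :: "nat \<Rightarrow> set_statistic \<times> set_statistic \<Rightarrow> bool" where
  "slot_pair n P \<longleftrightarrow> (\<exists>s s'. s \<noteq> s' \<and> (\<forall>\<sigma>\<in>stirling_perms n.
     fst P \<sigma> = slot_letters s \<sigma> \<and> snd P \<sigma> = slot_letters s \<sigma> - slot_letters s' \<sigma>))"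

lemma card_slot_letters:
  assumes "n \<ge> 1"
  shows "card {\<sigma> \<in> stirling_perms n. R (slot_letters s \<sigma>) (slot_letters s' \<sigma>)} =
    card {t \<in> increasing_trees n. R (vacant s t) (vacant s' t)}"
proof (rule sym, rule bij_betw_same_card)
  show "bij_betw word {t \<in> increasing_trees n. R (vacant s t) (vacant s' t)}
      {\<sigma> \<in> stirling_perms n. R (slot_letters s \<sigma>) (slot_letters s' \<sigma>)}"
    by (rule bij_betw_Collect [OF bij_betw_word]) (simp add: slot_letters_word [OF assms])
qed

lemma card_vacant:
  assumes "s \<noteq> s'" "u \<noteq> u'"
  shows "card {t \<in> increasing_trees n. R (vacant s t) (vacant s' t)} =
    card {t \<in> increasing_trees n. R (vacant u t) (vacant u' t)}"
proof -
  obtain p where p: "bij p" "p s = u" "p s' = u'"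
    using bij_extending_distinct_pair [OF assms] .
  have "bij_betw (permute_children p) {t \<in> increasing_trees n. R (vacant u t) (vacant u' t)}
      {t \<in> increasing_trees n. R (vacant s t) (vacant s' t)}"
    by (rule bij_betw_Collect [OF bij_betw_permute_children [OF p(1)]])
       (simp add: vacant_permute_children bij_is_surj p)
  then show ?thesis by (simp add: bij_betw_same_card)
qed

lemma equidistributed_slot_pairs:
  assumes "n \<ge> 1" "slot_pair n P" "slot_pair n P'"
  shows "equidistributed n P P'"
proof -
  obtain s s' where s: "s \<noteq> s'" "\<And>\<sigma>. \<sigma> \<in> stirling_perms n \<Longrightarrow>
      fst P \<sigma> = slot_letters s \<sigma> \<and> snd P \<sigma> = slot_letters s \<sigma> - slot_letters s' \<sigma>"
    using assms(2) unfolding slot_pair_def by blast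
  obtain u u' where u: "u \<noteq> u'" "\<And>\<sigma>. \<sigma> \<in> stirling_perms n \<Longrightarrow>
      fst P' \<sigma> = slot_letters u \<sigma> \<and> snd P' \<sigma> = slot_letters u \<sigma> - slot_letters u' \<sigma>"
    using assms(3) unfolding slot_pair_def by blast
  have "card {\<sigma> \<in> stirling_perms n. fst P \<sigma> = A \<and> snd P \<sigma> = B} =
      card {\<sigma> \<in> stirling_perms n. fst P' \<sigma> = A \<and> snd P' \<sigma> = B}" for A B
  proof -
    let ?R = "\<lambda>X Y. X = A \<and> X - Y = B"
    have "{\<sigma> \<in> stirling_perms n. fst P \<sigma> = A \<and> snd P \<sigma> = B} =
        {\<sigma> \<in> stirling_perms n. ?R (slot_letters s \<sigma>) (slot_letters s' \<sigma>)}"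
      using s(2) by auto
    moreover have "{\<sigma> \<in> stirling_perms n. fst P' \<sigma> = A \<and> snd P' \<sigma> = B} =
        {\<sigma> \<in> stirling_perms n. ?R (slot_letters u \<sigma>) (slot_letters u' \<sigma>)}"
      using u(2) by auto
    ultimately show ?thesis
      using card_slot_letters [OF assms(1), of ?R] card_vacant [OF s(1) u(1), of n ?R] by simp
  qed
  then show ?thesis by (simp add: equidistributed_def split_beta)
qed

text \<open>
  Grouping the sum by the values \<open>(A, B)\<close> of the two sets expresses the generating function
  through the numbers that equidistribution compares.
\<close>

lemma gen_fun_eq_if_equidistributed:
  assumes "equidistributed n (S, T) (S', T')"
    and "\<And>\<sigma>. \<sigma> \<in> stirling_perms n \<Longrightarrow>
      S \<sigma> \<subseteq> {1..n} \<and> T \<sigma> \<subseteq> {1..n} \<and> S' \<sigma> \<subseteq> {1..n} \<and> T' \<sigma> \<subseteq> {1..n}"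
  shows "gen_fun n (\<lambda>\<sigma>. card (S \<sigma>)) (\<lambda>\<sigma>. card (T \<sigma>)) x y =
    gen_fun n (\<lambda>\<sigma>. card (S' \<sigma>)) (\<lambda>\<sigma>. card (T' \<sigma>)) x y"
proof -
  have group: "gen_fun n (\<lambda>\<sigma>. card (F \<sigma>)) (\<lambda>\<sigma>. card (G \<sigma>)) x y =
      (\<Sum>(A, B)\<in>Pow {1..n} \<times> Pow {1..n}.
        of_nat (card {\<sigma> \<in> stirling_perms n. F \<sigma> = A \<and> G \<sigma> = B}) * (x ^ card A * y ^ card B))"
    if "\<And>\<sigma>. \<sigma> \<in> stirling_perms n \<Longrightarrow> F \<sigma> \<subseteq> {1..n} \<and> G \<sigma> \<subseteq> {1..n}" for F G
  proof -
    let ?h = "\<lambda>\<sigma>. x ^ card (F \<sigma>) * y ^ card (G \<sigma>)"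
    have "gen_fun n (\<lambda>\<sigma>. card (F \<sigma>)) (\<lambda>\<sigma>. card (G \<sigma>)) x y = sum ?h (stirling_perms n)"
      by (simp add: gen_fun_def)
    also have "\<dots> = (\<Sum>p\<in>Pow {1..n} \<times> Pow {1..n}.
        sum ?h {\<sigma> \<in> stirling_perms n. (F \<sigma>, G \<sigma>) = p})"
      using that by (intro sum.group [symmetric] finite_stirling_perms) auto
    also have "\<dots> = (\<Sum>(A, B)\<in>Pow {1..n} \<times> Pow {1..n}.
        of_nat (card {\<sigma> \<in> stirling_perms n. F \<sigma> = A \<and> G \<sigma> = B}) * (x ^ card A * y ^ card B))"
    proof (intro sum.cong refl, clarify)
      fix A B
      have "sum ?h {\<sigma> \<in> stirling_perms n. (F \<sigma>, G \<sigma>) = (A, B)} =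
          (\<Sum>\<sigma>\<in>{\<sigma> \<in> stirling_perms n. F \<sigma> = A \<and> G \<sigma> = B}. x ^ card A * y ^ card B)"
        by (rule sum.cong) auto
      then show "sum ?h {\<sigma> \<in> stirling_perms n. (F \<sigma>, G \<sigma>) = (A, B)} =
          of_nat (card {\<sigma> \<in> stirling_perms n. F \<sigma> = A \<and> G \<sigma> = B}) * (x ^ card A * y ^ card B)"
        by simp
    qed
    finally show ?thesis .
  qed
  have "gen_fun n (\<lambda>\<sigma>. card (S \<sigma>)) (\<lambda>\<sigma>. card (T \<sigma>)) x y =
      (\<Sum>(A, B)\<in>Pow {1..n} \<times> Pow {1..n}.
        of_nat (card {\<sigma> \<in> stirling_perms n. S \<sigma> = A \<and> T \<sigma> = B}) * (x ^ card A * y ^ card B))"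
    using assms(2) by (intro group) auto
  also have "\<dots> = (\<Sum>(A, B)\<in>Pow {1..n} \<times> Pow {1..n}.
        of_nat (card {\<sigma> \<in> stirling_perms n. S' \<sigma> = A \<and> T' \<sigma> = B}) * (x ^ card A * y ^ card B))"
    using assms(1) by (intro sum.cong refl) (auto simp: equidistributed_def)
  also have "\<dots> = gen_fun n (\<lambda>\<sigma>. card (S' \<sigma>)) (\<lambda>\<sigma>. card (T' \<sigma>)) x y"
    using assms(2) by (intro group [symmetric]) auto
  finally show ?thesis .
qed

theorem theorem13:
  fixes n :: nat and x y :: "'a::comm_semiring_1"
  assumes "n \<ge> 1"
  shows
    "(\<forall>P \<in> {(Asc, Dasc), (Plat, Dplat), (Des, Ddes), (Asc, Uu), (Plat, Pasc), (Des, Dd)}.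
      \<forall>P' \<in> {(Asc, Dasc), (Plat, Dplat), (Des, Ddes), (Asc, Uu), (Plat, Pasc), (Des, Dd)}.
        equidistributed n P P') \<and>
     (gen_fun n asc dasc x y = gen_fun n plat dplat x y \<and>
      gen_fun n plat dplat x y = gen_fun n des ddes x y) \<and>
     (gen_fun n asc dasc x y = gen_fun n plat pasc x y \<and>
      gen_fun n plat pasc x y = gen_fun n des ddes x y) \<and>
     (gen_fun n asc uu x y = gen_fun n plat pasc x y \<and>
      gen_fun n plat pasc x y = gen_fun n des dd x y) \<and>
     (gen_fun n asc uu x y = gen_fun n plat dplat x y \<and>
      gen_fun n plat dplat x y = gen_fun n des dd x y)"
proof -
  let ?pairs = "{(Asc, Dasc), (Plat, Dplat), (Des, Ddes), (Asc, Uu), (Plat, Pasc), (Des, Dd)}"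
  have slot_pairI: "slot_pair n (S, T)"
    if "s \<noteq> s'" "\<And>\<sigma>. \<sigma> \<in> stirling_perms n \<Longrightarrow> S \<sigma> = slot_letters s \<sigma>"
      "\<And>\<sigma>. \<sigma> \<in> stirling_perms n \<Longrightarrow> T \<sigma> = slot_letters s \<sigma> - slot_letters s' \<sigma>"
    for S T s s'
    unfolding slot_pair_def using that by fastforce
  note stats = Asc_eq_slot_letters Des_eq_slot_letters Plat_eq_slot_letters [OF _ assms]
    refined_statistics_eq_Diff
  have "slot_pair n (Asc, Dasc)"
    by (rule slot_pairI [of Before Between]) (simp_all add: stats)
  moreover have "slot_pair n (Asc, Uu)"
    by (rule slot_pairI [of Before After]) (simp_all add: stats)
  moreover have "slot_pair n (Plat, Dplat)"
    by (rule slot_pairI [of Between Before]) (simp_all add: stats)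
  moreover have "slot_pair n (Plat, Pasc)"
    by (rule slot_pairI [of Between After]) (simp_all add: stats)
  moreover have "slot_pair n (Des, Ddes)"
    by (rule slot_pairI [of After Between]) (simp_all add: stats)
  moreover have "slot_pair n (Des, Dd)"
    by (rule slot_pairI [of After Before]) (simp_all add: stats)
  ultimately have slots: "slot_pair n P" if "P \<in> ?pairs" for P
    using that by blast
  have equi: "equidistributed n P P'" if "P \<in> ?pairs" "P' \<in> ?pairs" for P P'
    using that by (intro equidistributed_slot_pairs assms slots)
  have range: "S \<sigma> \<subseteq> {1..n} \<and> T \<sigma> \<subseteq> {1..n}"
    if "(S, T) \<in> ?pairs" "\<sigma> \<in> stirling_perms n" for S T \<sigma>
  proof -
    have "S \<sigma> \<subseteq> letter \<sigma> ` positions \<sigma>" "T \<sigma> \<subseteq> S \<sigma>"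
      using that by (auto simp: Asc_def Plat_def Des_def refined_statistics_eq_Diff)
    then show ?thesis using letter_in_range [OF that(2)] by blast
  qed
  have gen_eq: "gen_fun n (\<lambda>\<sigma>. card (S \<sigma>)) (\<lambda>\<sigma>. card (T \<sigma>)) x y =
      gen_fun n (\<lambda>\<sigma>. card (S' \<sigma>)) (\<lambda>\<sigma>. card (T' \<sigma>)) x y"
    if "(S, T) \<in> ?pairs" "(S', T') \<in> ?pairs" for S T S' T'
    using range [OF that(1)] range [OF that(2)]
    by (intro gen_fun_eq_if_equidistributed equi that) blast
  have card: "asc = (\<lambda>\<sigma>. card (Asc \<sigma>))" "plat = (\<lambda>\<sigma>. card (Plat \<sigma>))"
    "des = (\<lambda>\<sigma>. card (Des \<sigma>))" "dasc = (\<lambda>\<sigma>. card (Dasc \<sigma>))"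
    "dplat = (\<lambda>\<sigma>. card (Dplat \<sigma>))" "ddes = (\<lambda>\<sigma>. card (Ddes \<sigma>))"
    "pasc = (\<lambda>\<sigma>. card (Pasc \<sigma>))" "uu = (\<lambda>\<sigma>. card (Uu \<sigma>))" "dd = (\<lambda>\<sigma>. card (Dd \<sigma>))"
    by (simp_all add: fun_eq_iff asc_def plat_def des_def dasc_def dplat_def ddes_def
        pasc_def uu_def dd_def)
  show ?thesis
    unfolding card by (intro conjI ballI equi gen_eq) (assumption | simp)+
qed

end
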